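(* Let $\mathbf f\in [H^{-1}(\Omega)]^3$ and let $(\mathbf u_h,p_h,\mathbf E_h,\mathbf B_h,\mathbf j_h)\in \mathbf X_h$ be any solution of the discrete stationary Hall MHD problem: for all $(\mathbf v_h,q_h,\mathbf F_h,\mathbf C_h,\mathbf k_h)\in\mathbf X_h$, $$\mathrm{Re}^{-1}(\nabla \mathbf u_h,\nabla \mathbf v_h)+((\mathbf u_h\cdot\nabla)\mathbf u_h,\mathbf v_h)-S(\mathbf j_h\times\mathbf B_h,\mathbf v_h)-(p_h,\nabla\cdot\mathbf v_h)=\langle\mathbf f,\mathbf v_h\rangle,$$ $$(\mathbf j_h,\mathbf F_h)-(\mathbf B_h,\nabla\times\mathbf F_h)=0,$$ $$(\nabla\times\mathbf E_h,\mathbf C_h)+(\nabla\cdot\mathbf B_h,\nabla\cdot\mathbf C_h)=0,$$ $$\mathrm{Re_m}^{-1}(\mathbf j_h,\mathbf k_h)-(\mathbf E_h+\mathbf u_h\times\mathbf B_h-R_H\,\mathbf j_h\times\mathbf B_h,\mathbf k_h)=0,$$ $$-(\nabla\cdot\mathbf u_h,q_h)=0.$$ Then: 1. (magnetic Gauss's law) $\nabla\cdot\mathbf B_h=0$; 2. (stationary Faraday's law) $\nabla\times\mathbf E_h=\mathbf 0$; 3. (energy estimates) $$\mathrm{Re}^{-1}\|\nabla\mathbf u_h\|^2+\mathrm{Re_m}^{-1}S\|\mathbf j_h\|^2=\langle\mathbf f,\mathbf u_h\rangle,$$ $$\tfrac12\mathrm{Re}^{-1}\|\nabla\mathbf u_h\|^2+\mathrm{Re_m}^{-1}S\|\mathbf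 j_h\|^2\le\tfrac{\mathrm{Re}}{2}\|\mathbf f\|_{-1}^2.$$
   Context: $\Omega\subset\mathbb R^3$ is a bounded, simply connected Lipschitz polyhedron; $(\cdot,\cdot)$ and $\|\cdot\|$ are the $L^2(\Omega)$ inner product and norm; $\langle\cdot,\cdot\rangle$ is the duality pairing between $H^{-1}(\Omega)$ and $H^1_0(\Omega)$, and $\|\mathbf f\|_{-1}=\sup_{\mathbf 0\ne\mathbf v\in [H^1_0(\Omega)]^3}\langle\mathbf f,\mathbf v\rangle/\|\nabla\mathbf v\|$. The constants $\mathrm{Re},\mathrm{Re_m},S>0$ (fluid Reynolds, magnetic Reynolds and coupling numbers) and $R_H\ge0$ (Hall parameter) are given. $H^h_0(\mathrm{grad})\subset H^1_0(\Omega)$, $\mathbf H^h_0(\mathrm{curl})\subset\mathbf H_0(\mathrm{curl},\Omega)$ (vanishing tangential trace), $\mathbf H^h_0(\mathrm{div})\subset\mathbf H_0(\mathrm{div},\Omega)$ (vanishing normal trace) and $L^2_h\subset L^2_0(\Omega)$ are conforming finite element spaces forming an exact discrete de Rham sequence $H^h_0(\mathrm{grad})\xrightarrow{\nabla}\mathbf H^h_0(\mathrm{curl})\xrightarrow{\nabla\times}\mathbf H^h_0(\mathrm{div})\xrightarrow{\nabla\cdot}L^2_h\to 0$. $\mathbf V_h\subset[H^1_0(\Omega)]^3$ and $Q_h\subset L^2_0(\Omega)$ (mean-zero functions) are inf-sup stable finite element spaces for velocity and pressure, such that the incompressibility constraint is enforced exactly: any $\mathbf v\in\mathbf V_h$ with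 $(\nabla\cdot\mathbf v,q)=0$ for all $q\in Q_h$ satisfies $\nabla\cdot\mathbf v=0$. Set $\mathbf X_h=\mathbf V_h\times Q_h\times\mathbf H^h_0(\mathrm{curl})\times\mathbf H^h_0(\mathrm{div})\times\mathbf H^h_0(\mathrm{curl})$. *)

theory Defs
  imports "HOL-Analysis.Analysis"
begin

section \<open>The domain\<close>

text \<open>
  In suitable orthonormal coordinates, near each boundary point the domain is the strict epigraph
  of a Lipschitz function of the first two coordinates.
\<close>

definition lipschitz_domain :: "(real^3) set \<Rightarrow> bool" where
  "lipschitz_domain \<Omega> \<longleftrightarrow> open \<Omega> \<and> connected \<Omega> \<and> \<Omega> \<noteq> {} \<and>
     (\<forall>x\<in>frontier \<Omega>. \<exists>r>0. \<exists>(R::real^3 \<Rightarrow> real^3) L (\<gamma>::real^2 \<Rightarrow> real).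
        orthogonal_transformation R \<and> L-lipschitz_on UNIV \<gamma> \<and>
        \<Omega> \<inter> ball x r = {y \<in> ball x r. \<gamma> (vector [R y $ 1, R y $ 2]) < R y $ 3})"

text \<open>
  The library's \<^const>\<open>polyhedron\<close> and \<^const>\<open>polytope\<close> are convex; a polyhedral domain need not be,
  so its closure is a finite union of polytopes.
\<close>

definition lipschitz_polyhedron :: "(real^3) set \<Rightarrow> bool" where
  "lipschitz_polyhedron \<Omega> \<longleftrightarrow> lipschitz_domain \<Omega> \<and> bounded \<Omega> \<and>
     (\<exists>\<P>. finite \<P> \<and> (\<forall>P\<in>\<P>. polytope P) \<and> closure \<Omega> = \<Union>\<P>)"


section \<open>Lebesgue spaces\<close>

text \<open>
  Elements of \<open>L\<^sup>2\<close> and of its subspaces are represented by functions on the whole space of which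
  only the values almost everywhere in \<open>\<Omega>\<close> matter. Equality in these spaces is
  \<open>ae_eq\<close>, and all operators below are meant up to \<open>ae_eq\<close>.
\<close>

definition ae_eq :: "(real^3) set \<Rightarrow> (real^3 \<Rightarrow> 'a) \<Rightarrow> (real^3 \<Rightarrow> 'a) \<Rightarrow> bool" where
  "ae_eq \<Omega> u v \<longleftrightarrow> (AE x in lebesgue_on \<Omega>. u x = v x)"

definition L2 :: "(real^3) set \<Rightarrow> (real^3 \<Rightarrow> 'a::euclidean_space) set" where
  "L2 \<Omega> = {u. u \<in> borel_measurable (lebesgue_on \<Omega>) \<and>
              integrable (lebesgue_on \<Omega>) (\<lambda>x. (norm (u x))\<^sup>2)}"

definition L2_inner ::
    "(real^3) set \<Rightarrow> (real^3 \<Rightarrow> 'a::euclidean_space) \<Rightarrow> (real^3 \<Rightarrow> 'a) \<Rightarrow> real" where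
  "L2_inner \<Omega> u v = (LINT x|lebesgue_on \<Omega>. u x \<bullet> v x)"

definition L2_norm :: "(real^3) set \<Rightarrow> (real^3 \<Rightarrow> 'a::euclidean_space) \<Rightarrow> real" where
  "L2_norm \<Omega> u = sqrt (L2_inner \<Omega> u u)"

definition L2_0 :: "(real^3) set \<Rightarrow> (real^3 \<Rightarrow> real) set" where
  "L2_0 \<Omega> = {q \<in> L2 \<Omega>. (LINT x|lebesgue_on \<Omega>. q x) = 0}"


section \<open>Test functions and classical derivatives\<close>

definition pderiv_at :: "3 \<Rightarrow> (real^3 \<Rightarrow> real) \<Rightarrow> real^3 \<Rightarrow> real" where
  "pderiv_at i \<phi> x = frechet_derivative \<phi> (at x) (axis i 1)"

primrec Ck :: "nat \<Rightarrow> (real^3 \<Rightarrow> real) \<Rightarrow> bool" where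
  "Ck 0 \<phi> \<longleftrightarrow> continuous_on UNIV \<phi>"
| "Ck (Suc k) \<phi> \<longleftrightarrow> (\<forall>x. \<phi> differentiable (at x)) \<and> (\<forall>i. Ck k (pderiv_at i \<phi>))"

definition test_fun :: "(real^3) set \<Rightarrow> (real^3 \<Rightarrow> real) set" where
  "test_fun \<Omega> = {\<phi>. (\<forall>k. Ck k \<phi>) \<and> compact (closure {x. \<phi> x \<noteq> 0}) \<and> closure {x. \<phi> x \<noteq> 0} \<subseteq> \<Omega>}"

definition test_field :: "(real^3) set \<Rightarrow> (real^3 \<Rightarrow> real^3) set" where
  "test_field \<Omega> = {\<Phi>. \<forall>i. (\<lambda>x. \<Phi> x $ i) \<in> test_fun \<Omega>}"

definition classical_grad :: "(real^3 \<Rightarrow> real) \<Rightarrow> real^3 \<Rightarrow> real^3" where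
  "classical_grad \<phi> x = (\<chi> i. pderiv_at i \<phi> x)"

definition classical_curl :: "(real^3 \<Rightarrow> real^3) \<Rightarrow> real^3 \<Rightarrow> real^3" where
  "classical_curl \<Phi> x =
     (let D = (\<lambda>i j. pderiv_at i (\<lambda>y. \<Phi> y $ j) x)
      in vector [D 2 3 - D 3 2, D 3 1 - D 1 3, D 1 2 - D 2 1])"

definition classical_div :: "(real^3 \<Rightarrow> real^3) \<Rightarrow> real^3 \<Rightarrow> real" where
  "classical_div \<Phi> x = (\<Sum>i\<in>UNIV. pderiv_at i (\<lambda>y. \<Phi> y $ i) x)"


section \<open>Weak derivatives\<close>

definition has_weak_grad :: "(real^3) set \<Rightarrow> (real^3 \<Rightarrow> real) \<Rightarrow> (real^3 \<Rightarrow> real^3) \<Rightarrow> bool" where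
  "has_weak_grad \<Omega> u g \<longleftrightarrow> g \<in> L2 \<Omega> \<and>
     (\<forall>\<Phi>\<in>test_field \<Omega>. L2_inner \<Omega> g \<Phi> = - L2_inner \<Omega> u (classical_div \<Phi>))"

definition has_weak_curl :: "(real^3) set \<Rightarrow> (real^3 \<Rightarrow> real^3) \<Rightarrow> (real^3 \<Rightarrow> real^3) \<Rightarrow> bool" where
  "has_weak_curl \<Omega> u w \<longleftrightarrow> w \<in> L2 \<Omega> \<and>
     (\<forall>\<Phi>\<in>test_field \<Omega>. L2_inner \<Omega> w \<Phi> = L2_inner \<Omega> u (classical_curl \<Phi>))"

definition has_weak_div :: "(real^3) set \<Rightarrow> (real^3 \<Rightarrow> real^3) \<Rightarrow> (real^3 \<Rightarrow> real) \<Rightarrow> bool" where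
  "has_weak_div \<Omega> u d \<longleftrightarrow> d \<in> L2 \<Omega> \<and>
     (\<forall>\<phi>\<in>test_fun \<Omega>. L2_inner \<Omega> d \<phi> = - L2_inner \<Omega> u (classical_grad \<phi>))"

text \<open>
  Weak derivatives are unique up to \<open>ae_eq\<close>; the operators pick a representative and are only
  meaningful on the corresponding Sobolev space.
\<close>

definition wgrad :: "(real^3) set \<Rightarrow> (real^3 \<Rightarrow> real) \<Rightarrow> real^3 \<Rightarrow> real^3" where
  "wgrad \<Omega> u = (SOME g. has_weak_grad \<Omega> u g)"

definition wcurl :: "(real^3) set \<Rightarrow> (real^3 \<Rightarrow> real^3) \<Rightarrow> real^3 \<Rightarrow> real^3" where
  "wcurl \<Omega> u = (SOME w. has_weak_curl \<Omega> u w)"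

definition wdiv :: "(real^3) set \<Rightarrow> (real^3 \<Rightarrow> real^3) \<Rightarrow> real^3 \<Rightarrow> real" where
  "wdiv \<Omega> u = (SOME d. has_weak_div \<Omega> u d)"

text \<open>The entry \<open>wGrad \<Omega> u x $ i $ j\<close> is \<open>\<partial>\<^sub>j u\<^sub>i\<close>, so that \<open>(w \<cdot> \<nabla>) u\<close> is a matrix-vector product.\<close>

definition wGrad :: "(real^3) set \<Rightarrow> (real^3 \<Rightarrow> real^3) \<Rightarrow> real^3 \<Rightarrow> real^3^3" where
  "wGrad \<Omega> u x = (\<chi> i. wgrad \<Omega> (\<lambda>y. u y $ i) x)"

definition convect :: "(real^3) set \<Rightarrow> (real^3 \<Rightarrow> real^3) \<Rightarrow> (real^3 \<Rightarrow> real^3) \<Rightarrow> real^3 \<Rightarrow> real^3" where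
  "convect \<Omega> w u x = wGrad \<Omega> u x *v w x"


section \<open>Sobolev spaces\<close>

definition H1 :: "(real^3) set \<Rightarrow> (real^3 \<Rightarrow> real) set" where
  "H1 \<Omega> = {u \<in> L2 \<Omega>. \<exists>g. has_weak_grad \<Omega> u g}"

definition H_curl :: "(real^3) set \<Rightarrow> (real^3 \<Rightarrow> real^3) set" where
  "H_curl \<Omega> = {u \<in> L2 \<Omega>. \<exists>w. has_weak_curl \<Omega> u w}"

definition H_div :: "(real^3) set \<Rightarrow> (real^3 \<Rightarrow> real^3) set" where
  "H_div \<Omega> = {u \<in> L2 \<Omega>. \<exists>d. has_weak_div \<Omega> u d}"

text \<open>\<open>H\<^sup>1\<^sub>0\<close> is the closure of the test functions in \<open>H\<^sup>1\<close>.\<close>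

definition H1_0 :: "(real^3) set \<Rightarrow> (real^3 \<Rightarrow> real) set" where
  "H1_0 \<Omega> = {u \<in> H1 \<Omega>. \<exists>\<phi>::nat \<Rightarrow> real^3 \<Rightarrow> real. (\<forall>n. \<phi> n \<in> test_fun \<Omega>) \<and>
      (\<lambda>n. L2_norm \<Omega> (\<lambda>x. \<phi> n x - u x)) \<longlonglongrightarrow> 0 \<and>
      (\<lambda>n. L2_norm \<Omega> (\<lambda>x. classical_grad (\<phi> n) x - wgrad \<Omega> u x)) \<longlonglongrightarrow> 0}"

definition H1_vec :: "(real^3) set \<Rightarrow> (real^3 \<Rightarrow> real^3) set" where
  "H1_vec \<Omega> = {u. \<forall>i. (\<lambda>x. u x $ i) \<in> H1 \<Omega>}"

definition H1_0_vec :: "(real^3) set \<Rightarrow> (real^3 \<Rightarrow> real^3) set" where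
  "H1_0_vec \<Omega> = {u. \<forall>i. (\<lambda>x. u x $ i) \<in> H1_0 \<Omega>}"

text \<open>
  The tangential trace \<open>\<nu> \<times> u\<close> of \<open>u \<in> H(curl)\<close> and the normal trace \<open>\<nu> \<cdot> u\<close> of \<open>u \<in> H(div)\<close> lie in
  \<open>H\<^sup>-\<^sup>1\<^sup>/\<^sup>2(\<partial>\<Omega>)\<close> and are defined by Green's formula, as functionals of the trace of \<open>v\<close> in \<open>H\<^sup>1\<close>.
\<close>

definition tangential_trace ::
    "(real^3) set \<Rightarrow> (real^3 \<Rightarrow> real^3) \<Rightarrow> (real^3 \<Rightarrow> real^3) \<Rightarrow> real" where
  "tangential_trace \<Omega> u v = L2_inner \<Omega> (wcurl \<Omega> u) v - L2_inner \<Omega> u (wcurl \<Omega> v)"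

definition normal_trace ::
    "(real^3) set \<Rightarrow> (real^3 \<Rightarrow> real^3) \<Rightarrow> (real^3 \<Rightarrow> real) \<Rightarrow> real" where
  "normal_trace \<Omega> u v = L2_inner \<Omega> (wdiv \<Omega> u) v + L2_inner \<Omega> u (wgrad \<Omega> v)"

definition H_curl_0 :: "(real^3) set \<Rightarrow> (real^3 \<Rightarrow> real^3) set" where
  "H_curl_0 \<Omega> = {u \<in> H_curl \<Omega>. \<forall>v\<in>H1_vec \<Omega>. tangential_trace \<Omega> u v = 0}"

definition H_div_0 :: "(real^3) set \<Rightarrow> (real^3 \<Rightarrow> real^3) set" where
  "H_div_0 \<Omega> = {u \<in> H_div \<Omega>. \<forall>v\<in>H1 \<Omega>. normal_trace \<Omega> u v = 0}"


section \<open>The dual space of \<open>H\<^sup>1\<^sub>0\<close>\<close>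

text \<open>\<open>H\<^sup>1\<^sub>0\<close> carries the norm \<open>\<parallel>\<nabla>v\<parallel>\<close>.\<close>

definition H_minus1 :: "(real^3) set \<Rightarrow> ((real^3 \<Rightarrow> real) \<Rightarrow> real) set" where
  "H_minus1 \<Omega> = {l.
     (\<forall>v\<in>H1_0 \<Omega>. \<forall>w\<in>H1_0 \<Omega>. \<forall>a b. l (\<lambda>x. a * v x + b * w x) = a * l v + b * l w) \<and>
     (\<exists>C. \<forall>v\<in>H1_0 \<Omega>. \<bar>l v\<bar> \<le> C * L2_norm \<Omega> (wgrad \<Omega> v))}"

definition H_minus1_vec :: "(real^3) set \<Rightarrow> (((real^3 \<Rightarrow> real) \<Rightarrow> real)^3) set" where
  "H_minus1_vec \<Omega> = {f. \<forall>i. f $ i \<in> H_minus1 \<Omega>}"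

definition pairing :: "((real^3 \<Rightarrow> real) \<Rightarrow> real)^3 \<Rightarrow> (real^3 \<Rightarrow> real^3) \<Rightarrow> real" where
  "pairing f v = (\<Sum>i\<in>UNIV. (f $ i) (\<lambda>x. v x $ i))"

definition dual_norm :: "(real^3) set \<Rightarrow> ((real^3 \<Rightarrow> real) \<Rightarrow> real)^3 \<Rightarrow> real" where
  "dual_norm \<Omega> f =
     (SUP v\<in>{v \<in> H1_0_vec \<Omega>. \<not> ae_eq \<Omega> v (\<lambda>x. 0)}. pairing f v / L2_norm \<Omega> (wGrad \<Omega> v))"


section \<open>Finite element spaces\<close>

definition mesh :: "(real^3) set \<Rightarrow> (real^3) set set \<Rightarrow> bool" where
  "mesh \<Omega> \<T> \<longleftrightarrow> finite \<T> \<and> \<Union>\<T> = closure \<Omega> \<and>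
     (\<forall>K\<in>\<T>. polytope K \<and> interior K \<noteq> {}) \<and>
     (\<forall>K\<in>\<T>. \<forall>L\<in>\<T>. K \<noteq> L \<longrightarrow> interior K \<inter> interior L = {})"

text \<open>
  A finite-dimensional space of functions that on each cell of a mesh are continuous up to the
  boundary of the cell; this includes piecewise polynomials. No continuity across cells is imposed
  here: it comes from conformity, i.e. inclusion in the respective Sobolev space.
\<close>

definition fe_space :: "(real^3) set \<Rightarrow> (real^3 \<Rightarrow> 'a::euclidean_space) set \<Rightarrow> bool" where
  "fe_space \<Omega> V \<longleftrightarrow>
     (\<exists>B. finite B \<and> V = {\<lambda>x. \<Sum>b\<in>B. c b *\<^sub>R b x | c. True}) \<and>
     (\<exists>\<T>. mesh \<Omega> \<T> \<and>
        (\<forall>v\<in>V. \<forall>K\<in>\<T>. \<exists>g. continuous_on K g \<and> (\<forall>x\<in>interior K. v x = g x)))"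

definition maps_into ::
    "(real^3) set \<Rightarrow> ((real^3 \<Rightarrow> 'a) \<Rightarrow> (real^3 \<Rightarrow> 'b)) \<Rightarrow> (real^3 \<Rightarrow> 'a) set \<Rightarrow> (real^3 \<Rightarrow> 'b) set \<Rightarrow> bool"
  where "maps_into \<Omega> D V W \<longleftrightarrow> (\<forall>v\<in>V. \<exists>w\<in>W. ae_eq \<Omega> w (D v))"

definition in_range ::
    "(real^3) set \<Rightarrow> ((real^3 \<Rightarrow> 'a) \<Rightarrow> (real^3 \<Rightarrow> 'b)) \<Rightarrow> (real^3 \<Rightarrow> 'a) set \<Rightarrow> (real^3 \<Rightarrow> 'b) \<Rightarrow> bool"
  where "in_range \<Omega> D V w \<longleftrightarrow> (\<exists>v\<in>V. ae_eq \<Omega> w (D v))"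

definition exact_de_Rham ::
    "(real^3) set \<Rightarrow> (real^3 \<Rightarrow> real) set \<Rightarrow> (real^3 \<Rightarrow> real^3) set \<Rightarrow> (real^3 \<Rightarrow> real^3) set
      \<Rightarrow> (real^3 \<Rightarrow> real) set \<Rightarrow> bool" where
  "exact_de_Rham \<Omega> Hg Hc Hd Lh \<longleftrightarrow>
     maps_into \<Omega> (wgrad \<Omega>) Hg Hc \<and> maps_into \<Omega> (wcurl \<Omega>) Hc Hd \<and> maps_into \<Omega> (wdiv \<Omega>) Hd Lh \<and>
     (\<forall>w\<in>Hc. ae_eq \<Omega> (wcurl \<Omega> w) (\<lambda>x. 0) \<longleftrightarrow> in_range \<Omega> (wgrad \<Omega>) Hg w) \<and>
     (\<forall>C\<in>Hd. ae_eq \<Omega> (wdiv \<Omega> C) (\<lambda>x. 0) \<longleftrightarrow> in_range \<Omega> (wcurl \<Omega>) Hc C) \<and>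
     (\<forall>q\<in>Lh. in_range \<Omega> (wdiv \<Omega>) Hd q)"

text \<open>The supremum may include \<open>v = 0\<close>, which contributes \<open>0 / 0 = 0\<close>.\<close>

definition inf_sup_stable ::
    "(real^3) set \<Rightarrow> (real^3 \<Rightarrow> real^3) set \<Rightarrow> (real^3 \<Rightarrow> real) set \<Rightarrow> bool" where
  "inf_sup_stable \<Omega> V Q \<longleftrightarrow>
     (\<exists>\<beta>>0. \<forall>q\<in>Q. \<beta> * L2_norm \<Omega> q \<le>
        (SUP v\<in>V. L2_inner \<Omega> (wdiv \<Omega> v) q / L2_norm \<Omega> (wGrad \<Omega> v)))"

definition exactly_incompressible ::
    "(real^3) set \<Rightarrow> (real^3 \<Rightarrow> real^3) set \<Rightarrow> (real^3 \<Rightarrow> real) set \<Rightarrow> bool" where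
  "exactly_incompressible \<Omega> V Q \<longleftrightarrow>
     (\<forall>v\<in>V. (\<forall>q\<in>Q. L2_inner \<Omega> (wdiv \<Omega> v) q = 0) \<longrightarrow> ae_eq \<Omega> (wdiv \<Omega> v) (\<lambda>x. 0))"

end

theory Submission
  imports Defs
begin

text \<open>
  The two Maxwell laws come from testing Faraday's equation twice. Because the discrete spaces form a
  complex, \<open>curl E\<close> has a representative in the div-conforming space and that representative is
  divergence free; testing with it kills the divergence term and leaves \<open>\<parallel>curl E\<parallel>\<^sup>2 = 0\<close>. Testing
  with \<open>B\<close> then leaves \<open>\<parallel>div B\<parallel>\<^sup>2 = 0\<close>.

  For the energy identity, test the momentum equation with \<open>u\<close>, Ohm's law with \<open>j\<close> and Ampere's law
  with \<open>E\<close>. Ampere's law and \<open>curl E = 0\<close> give \<open>(j, E) = 0\<close>; the Hall term is orthogonal to \<open>j\<close> pointwise;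
  so Ohm's law reduces to \<open>Rey\<^sub>m\<^sup>-\<^sup>1 \<parallel>j\<parallel>\<^sup>2 = (u \<times> B, j) = - (j \<times> B, u)\<close>, and the work of the Lorentz force is
  exactly the Ohmic dissipation. The pressure term vanishes because \<open>u\<close> is exactly divergence free.

  The analytic point is that the convection term vanishes (\<open>convection_energy_zero\<close>). For a smooth compactly
  supported \<open>\<phi>\<close> it is the weak divergence equation \<open>2 \<integral>\<phi> u \<cdot> \<nabla>\<phi> = \<integral>u \<cdot> \<nabla>(\<phi>\<^sup>2) = 0\<close>. To pass to the limit
  \<open>\<phi> \<rightarrow> u\<^sub>i\<close> in \<open>H\<^sup>1\<close> one would in general need a Sobolev embedding, but a finite element velocity is
  essentially bounded (\<open>fe_space_AE_bounded\<close>), and then \<open>L\<^sup>2\<close> convergence of \<open>\<phi>\<close> and of \<open>\<nabla>\<phi>\<close> is enough.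
  The same bound makes \<open>u \<times> B\<close> square integrable, so that Ohm's law can be split into its terms.

  The estimate follows from the identity by \<open>\<langle>f, u\<rangle> \<le> \<parallel>f\<parallel>\<^sub>-\<^sub>1 \<parallel>\<nabla>u\<parallel>\<close> (\<open>pairing_le_dual_norm\<close>) and Young's inequality.
\<close>

section \<open>Square-integrable fields\<close>

lemma L2_measurable: "u \<in> L2 \<Omega> \<Longrightarrow> u \<in> borel_measurable (lebesgue_on \<Omega>)"
  by (simp add: L2_def)

lemma L2_square_integrable: "u \<in> L2 \<Omega> \<Longrightarrow> integrable (lebesgue_on \<Omega>) (\<lambda>x. (norm (u x))\<^sup>2)"
  by (simp add: L2_def)

lemma L2_dominated:
  assumes "u \<in> borel_measurable (lebesgue_on \<Omega>)" and "integrable (lebesgue_on \<Omega>) g"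
    and "AE x in lebesgue_on \<Omega>. (norm (u x))\<^sup>2 \<le> g x"
  shows "u \<in> L2 \<Omega>"
proof -
  have "integrable (lebesgue_on \<Omega>) (\<lambda>x. (norm (u x))\<^sup>2)"
    using assms(2)
  proof (rule Bochner_Integration.integrable_bound)
    show "(\<lambda>x. (norm (u x))\<^sup>2) \<in> borel_measurable (lebesgue_on \<Omega>)"
      using assms(1) by measurable
    show "AE x in lebesgue_on \<Omega>. norm ((norm (u x))\<^sup>2) \<le> norm (g x)"
      using assms(3) by eventually_elim auto
  qed
  with assms(1) show ?thesis by (simp add: L2_def)
qed

lemma L2_add:
  assumes "u \<in> L2 \<Omega>" "v \<in> L2 \<Omega>"
  shows "(\<lambda>x. u x + v x) \<in> L2 \<Omega>"
proof (rule L2_dominated)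
  show "(\<lambda>x. u x + v x) \<in> borel_measurable (lebesgue_on \<Omega>)"
    using assms[THEN L2_measurable] by measurable
  show "integrable (lebesgue_on \<Omega>) (\<lambda>x. 2 * (norm (u x))\<^sup>2 + 2 * (norm (v x))\<^sup>2)"
    using assms[THEN L2_square_integrable] by auto
  have "(norm (u x + v x))\<^sup>2 \<le> 2 * (norm (u x))\<^sup>2 + 2 * (norm (v x))\<^sup>2" for x
  proof -
    have "(norm (u x + v x))\<^sup>2 \<le> (norm (u x) + norm (v x))\<^sup>2"
      by (intro power_mono norm_triangle_ineq) auto
    also have "\<dots> \<le> 2 * (norm (u x))\<^sup>2 + 2 * (norm (v x))\<^sup>2"
      using sum_squares_ge_zero[of "norm (u x) - norm (v x)" 0]
      by (simp add: power2_eq_square algebra_simps)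
    finally show ?thesis .
  qed
  then show "AE x in lebesgue_on \<Omega>. (norm (u x + v x))\<^sup>2 \<le> 2 * (norm (u x))\<^sup>2 + 2 * (norm (v x))\<^sup>2"
    by simp
qed

lemma L2_scaleR:
  assumes "u \<in> L2 \<Omega>"
  shows "(\<lambda>x. c *\<^sub>R u x) \<in> L2 \<Omega>"
  using assms by (auto simp: L2_def power_mult_distrib)

lemma L2_diff:
  assumes "u \<in> L2 \<Omega>" "v \<in> L2 \<Omega>"
  shows "(\<lambda>x. u x - v x) \<in> L2 \<Omega>"
  using L2_add[OF assms(1) L2_scaleR[OF assms(2), of "-1"]] by simp

lemma L2_vec_nth:
  fixes u :: "real^3 \<Rightarrow> real^'n"
  assumes "u \<in> L2 \<Omega>"
  shows "(\<lambda>x. u x $ i) \<in> L2 \<Omega>"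
proof (rule L2_dominated)
  show "(\<lambda>x. u x $ i) \<in> borel_measurable (lebesgue_on \<Omega>)"
    using borel_measurable_inner[OF L2_measurable[OF assms] borel_measurable_const[of "axis i 1"]]
    by (simp add: inner_axis)
  show "AE x in lebesgue_on \<Omega>. (norm (u x $ i))\<^sup>2 \<le> (norm (u x))\<^sup>2"
    by (intro always_eventually allI power_mono) (auto simp: component_le_norm_cart)
qed (rule L2_square_integrable[OF assms])

lemma L2_vecI:
  fixes u :: "real^3 \<Rightarrow> real^'n"
  assumes c: "\<And>i. (\<lambda>x. u x $ i) \<in> L2 \<Omega>"
  shows "u \<in> L2 \<Omega>"
proof (rule L2_dominated)
  show "u \<in> borel_measurable (lebesgue_on \<Omega>)"
    using c[THEN L2_measurable]
    by (subst borel_measurable_euclidean_space) (auto simp: Basis_vec_def inner_axis)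
  show "integrable (lebesgue_on \<Omega>) (\<lambda>x. \<Sum>i\<in>UNIV. (norm (u x $ i))\<^sup>2)"
    using c[THEN L2_square_integrable] by auto
  show "AE x in lebesgue_on \<Omega>. (norm (u x))\<^sup>2 \<le> (\<Sum>i\<in>UNIV. (norm (u x $ i))\<^sup>2)"
    by (simp add: norm_vec_def L2_set_def sum_nonneg)
qed

lemma L2_inner_integrable:
  assumes "u \<in> L2 \<Omega>" "v \<in> L2 \<Omega>"
  shows "integrable (lebesgue_on \<Omega>) (\<lambda>x. u x \<bullet> v x)"
proof (rule Bochner_Integration.integrable_bound)
  show "integrable (lebesgue_on \<Omega>) (\<lambda>x. (norm (u x))\<^sup>2 + (norm (v x))\<^sup>2)"
    using assms[THEN L2_square_integrable] by auto
  show "(\<lambda>x. u x \<bullet> v x) \<in> borel_measurable (lebesgue_on \<Omega>)"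
    using assms[THEN L2_measurable] by measurable
  have "\<bar>u x \<bullet> v x\<bar> \<le> (norm (u x))\<^sup>2 + (norm (v x))\<^sup>2" for x
  proof -
    have "0 \<le> (norm (u x) - norm (v x))\<^sup>2" "0 \<le> norm (u x) * norm (v x)" by auto
    then have "norm (u x) * norm (v x) \<le> (norm (u x))\<^sup>2 + (norm (v x))\<^sup>2"
      unfolding power2_diff by linarith
    then show ?thesis
      using Cauchy_Schwarz_ineq2[of "u x" "v x"] by linarith
  qed
  then show "AE x in lebesgue_on \<Omega>. norm (u x \<bullet> v x) \<le> norm ((norm (u x))\<^sup>2 + (norm (v x))\<^sup>2)"
    by simp
qed

lemma L2_inner_commute: "L2_inner \<Omega> u v = L2_inner \<Omega> v u"
  by (simp add: L2_inner_def inner_commute)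

lemma L2_inner_add_left:
  assumes "u \<in> L2 \<Omega>" "v \<in> L2 \<Omega>" "w \<in> L2 \<Omega>"
  shows "L2_inner \<Omega> (\<lambda>x. u x + v x) w = L2_inner \<Omega> u w + L2_inner \<Omega> v w"
  using assms by (simp add: L2_inner_def inner_add_left L2_inner_integrable)

lemma L2_inner_diff_left:
  assumes "u \<in> L2 \<Omega>" "v \<in> L2 \<Omega>" "w \<in> L2 \<Omega>"
  shows "L2_inner \<Omega> (\<lambda>x. u x - v x) w = L2_inner \<Omega> u w - L2_inner \<Omega> v w"
  using assms by (simp add: L2_inner_def inner_diff_left L2_inner_integrable)

lemma L2_inner_diff_right:
  assumes "u \<in> L2 \<Omega>" "v \<in> L2 \<Omega>" "w \<in> L2 \<Omega>"
  shows "L2_inner \<Omega> w (\<lambda>x. u x - v x) = L2_inner \<Omega> w u - L2_inner \<Omega> w v"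
  using assms by (simp add: L2_inner_def inner_diff_right L2_inner_integrable)

lemma L2_inner_vec:
  fixes u v :: "real^3 \<Rightarrow> 'a::euclidean_space^'n"
  assumes "\<And>i. (\<lambda>x. u x $ i) \<in> L2 \<Omega>" "\<And>i. (\<lambda>x. v x $ i) \<in> L2 \<Omega>"
  shows "L2_inner \<Omega> u v = (\<Sum>i\<in>UNIV. L2_inner \<Omega> (\<lambda>x. u x $ i) (\<lambda>x. v x $ i))"
  unfolding L2_inner_def inner_vec_def
  by (rule Bochner_Integration.integral_sum) (use assms L2_inner_integrable in blast)

lemma L2_inner_eq_0_AE:
  assumes "AE x in lebesgue_on \<Omega>. u x = 0 \<or> v x = 0"
  shows "L2_inner \<Omega> u v = 0"
  unfolding L2_inner_def
  by (rule integral_eq_zero_AE) (use assms in eventually_elim, auto)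

lemma L2_inner_self_nonneg: "0 \<le> L2_inner \<Omega> u u"
  unfolding L2_inner_def by (rule integral_nonneg_AE) simp

lemma L2_norm_nonneg [simp]: "0 \<le> L2_norm \<Omega> u"
  by (simp add: L2_norm_def L2_inner_self_nonneg)

lemma L2_norm_power2: "(L2_norm \<Omega> u)\<^sup>2 = L2_inner \<Omega> u u"
  by (simp add: L2_norm_def L2_inner_self_nonneg)

lemma L2_inner_self_eq_0D:
  assumes "u \<in> L2 \<Omega>" "L2_inner \<Omega> u u = 0"
  shows "ae_eq \<Omega> u (\<lambda>x. 0)"
proof -
  have "AE x in lebesgue_on \<Omega>. u x \<bullet> u x = 0"
    using integral_nonneg_eq_0_iff_AE[OF L2_inner_integrable[OF assms(1,1)]] assms(2)
    by (simp add: L2_inner_def)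
  then show ?thesis by (simp add: ae_eq_def)
qed

lemma L2_Cauchy_Schwarz:
  assumes "u \<in> L2 \<Omega>" "v \<in> L2 \<Omega>"
  shows "\<bar>L2_inner \<Omega> u v\<bar> \<le> L2_norm \<Omega> u * L2_norm \<Omega> v"
proof -
  let ?a = "L2_inner \<Omega> u u" and ?b = "L2_inner \<Omega> u v" and ?c = "L2_inner \<Omega> v v"
  have "?b\<^sup>2 \<le> ?a * ?c"
  proof (cases "?c = 0")
    case True
    then have "AE x in lebesgue_on \<Omega>. v x = 0"
      using L2_inner_self_eq_0D[OF assms(2)] by (simp add: ae_eq_def)
    \<comment> \<open>Both sides vanish for \<open>v = 0\<close>, where there is no projection onto \<open>v\<close>.\<close>
    then have "?b = 0"
      by (intro L2_inner_eq_0_AE) auto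
    then show ?thesis using True by simp
  next
    case False
    then have c: "?c > 0" using L2_inner_self_nonneg[of \<Omega> v] by linarith
    \<comment> \<open>The best approximation of \<open>u\<close> by multiples of \<open>v\<close>.\<close>
    define t where "t = ?b / ?c"
    let ?w = "\<lambda>x. u x - t *\<^sub>R v x"
    have tv: "(\<lambda>x. t *\<^sub>R v x) \<in> L2 \<Omega>" and w: "?w \<in> L2 \<Omega>"
      using assms by (auto intro: L2_scaleR L2_diff)
    have scale: "L2_inner \<Omega> y (\<lambda>x. t *\<^sub>R v x) = t * L2_inner \<Omega> y v" for y
      by (simp add: L2_inner_def)
    have "0 \<le> L2_inner \<Omega> ?w ?w" by (rule L2_inner_self_nonneg)
    also have "\<dots> = (?a - t * ?b) - (t * ?b - t * (t * ?c))"
      using assms tv w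
      by (simp add: L2_inner_diff_left L2_inner_diff_right scale)
         (simp add: L2_inner_commute[of \<Omega> "\<lambda>x. t *\<^sub>R v x"] scale L2_inner_commute[of \<Omega> v u])
    finally show ?thesis
      using c by (simp add: t_def power2_eq_square field_simps)
  qed
  then have "\<bar>?b\<bar> \<le> sqrt (?a * ?c)"
    using real_le_rsqrt by (metis power2_abs)
  then show ?thesis by (simp add: L2_norm_def real_sqrt_mult)
qed

text \<open>
  Continuity of the inner product under strong convergence of both arguments; every passage from
  test functions to \<open>H\<^sup>1\<^sub>0\<close> goes through it.
\<close>
lemma L2_inner_tendsto:
  assumes L2: "\<And>n. a n \<in> L2 \<Omega>" "\<And>n. b n \<in> L2 \<Omega>" "a' \<in> L2 \<Omega>" "b' \<in> L2 \<Omega>"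
    and a: "(\<lambda>n. L2_norm \<Omega> (\<lambda>x. a n x - a' x)) \<longlonglongrightarrow> 0"
    and b: "(\<lambda>n. L2_norm \<Omega> (\<lambda>x. b n x - b' x)) \<longlonglongrightarrow> 0"
  shows "(\<lambda>n. L2_inner \<Omega> (a n) (b n)) \<longlonglongrightarrow> L2_inner \<Omega> a' b'"
proof -
  let ?da = "\<lambda>n. L2_norm \<Omega> (\<lambda>x. a n x - a' x)" and ?db = "\<lambda>n. L2_norm \<Omega> (\<lambda>x. b n x - b' x)"
  have bound: "\<bar>L2_inner \<Omega> (a n) (b n) - L2_inner \<Omega> a' b'\<bar>
      \<le> ?da n * ?db n + L2_norm \<Omega> a' * ?db n + ?da n * L2_norm \<Omega> b'" for n
  proof -
    have d: "(\<lambda>x. a n x - a' x) \<in> L2 \<Omega>" "(\<lambda>x. b n x - b' x) \<in> L2 \<Omega>"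
      using L2 by (auto intro: L2_diff)
    have "L2_inner \<Omega> (a n) (b n) - L2_inner \<Omega> a' b'
      = L2_inner \<Omega> (\<lambda>x. a n x - a' x) (\<lambda>x. b n x - b' x)
        + L2_inner \<Omega> a' (\<lambda>x. b n x - b' x) + L2_inner \<Omega> (\<lambda>x. a n x - a' x) b'"
      using L2 d by (simp add: L2_inner_diff_left L2_inner_diff_right)
    then show ?thesis
      using L2_Cauchy_Schwarz[OF d] L2_Cauchy_Schwarz[OF L2(3) d(2)] L2_Cauchy_Schwarz[OF d(1) L2(4)]
      by linarith
  qed
  have "(\<lambda>n. ?da n * ?db n + L2_norm \<Omega> a' * ?db n + ?da n * L2_norm \<Omega> b') \<longlonglongrightarrow> 0"
    by (rule tendsto_eq_rhs, (rule tendsto_intros a b)+) simp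
  then have "(\<lambda>n. L2_inner \<Omega> (a n) (b n) - L2_inner \<Omega> a' b') \<longlonglongrightarrow> 0"
    by (rule Lim_null_comparison[rotated]) (unfold real_norm_def, rule always_eventually, rule allI, rule bound)
  then show ?thesis by (rule LIM_zero_cancel)
qed

text \<open>
  A common source for products of an essentially bounded factor with a square-integrable one: the
  scaled fields \<open>\<phi> w\<close> of the convection term and the cross product \<open>u \<times> B\<close>.
\<close>
lemma L2_bilinear_bounded_factor:
  fixes \<beta> :: "'a::euclidean_space \<Rightarrow> 'b::euclidean_space \<Rightarrow> 'c::euclidean_space"
  assumes \<beta>: "bounded_bilinear \<beta>" "\<And>a b. norm (\<beta> a b) \<le> norm a * norm b"
    and v: "v \<in> borel_measurable (lebesgue_on \<Omega>)" "AE x in lebesgue_on \<Omega>. norm (v x) \<le> M"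
    and w: "w \<in> L2 \<Omega>"
  shows "(\<lambda>x. \<beta> (v x) (w x)) \<in> L2 \<Omega>"
    and "0 \<le> M \<Longrightarrow> L2_norm \<Omega> (\<lambda>x. \<beta> (v x) (w x)) \<le> M * L2_norm \<Omega> w"
proof -
  have int: "integrable (lebesgue_on \<Omega>) (\<lambda>x. M\<^sup>2 * (norm (w x))\<^sup>2)"
    using L2_square_integrable[OF w] by simp
  have ae: "AE x in lebesgue_on \<Omega>. (norm (\<beta> (v x) (w x)))\<^sup>2 \<le> M\<^sup>2 * (norm (w x))\<^sup>2"
    using v(2)
  proof eventually_elim
    case (elim x)
    then have "norm (\<beta> (v x) (w x)) \<le> M * norm (w x)"
      using \<beta>(2) mult_right_mono[OF elim norm_ge_zero] order_trans by blast
    then have "(norm (\<beta> (v x) (w x)))\<^sup>2 \<le> (M * norm (w x))\<^sup>2"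
      by (intro power_mono) auto
    then show ?case by (simp add: power_mult_distrib)
  qed
  have meas: "(\<lambda>x. \<beta> (v x) (w x)) \<in> borel_measurable (lebesgue_on \<Omega>)"
  proof (rule borel_measurable_continuous_Pair[OF v(1) L2_measurable[OF w]])
    show "continuous_on UNIV (\<lambda>x. \<beta> (fst x) (snd x))"
      by (rule bounded_bilinear.continuous_on[OF \<beta>(1)]) (intro continuous_intros)+
  qed
  show L2: "(\<lambda>x. \<beta> (v x) (w x)) \<in> L2 \<Omega>"
    by (rule L2_dominated[OF meas int ae])
  assume "0 \<le> M"
  have "L2_inner \<Omega> (\<lambda>x. \<beta> (v x) (w x)) (\<lambda>x. \<beta> (v x) (w x)) \<le> M\<^sup>2 * L2_inner \<Omega> w w"
    using integral_mono_AE[OF L2_square_integrable[OF L2] int ae]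
    by (simp add: L2_inner_def power2_norm_eq_inner)
  then show "L2_norm \<Omega> (\<lambda>x. \<beta> (v x) (w x)) \<le> M * L2_norm \<Omega> w"
    unfolding L2_norm_def using \<open>0 \<le> M\<close>
    by (metis real_sqrt_le_mono real_sqrt_mult real_sqrt_unique)
qed

lemma L2_cross3_bounded_factor:
  assumes "a \<in> borel_measurable (lebesgue_on \<Omega>)" "AE x in lebesgue_on \<Omega>. norm (a x) \<le> M"
    and "b \<in> L2 \<Omega>"
  shows "(\<lambda>x. cross3 (a x) (b x)) \<in> L2 \<Omega>"
proof (rule L2_bilinear_bounded_factor(1)[OF _ _ assms])
  show "bounded_bilinear cross3"
    using bilinear_cross bilinear_conv_bounded_bilinear by blast
  show "norm (cross3 a b) \<le> norm a * norm b" for a b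
  proof (rule power2_le_imp_le)
    show "(norm (cross3 a b))\<^sup>2 \<le> (norm a * norm b)\<^sup>2"
      using norm_cross_dot[of a b] by (metis le_add_same_cancel1 zero_le_power2)
  qed simp
qed

section \<open>Test functions\<close>

lemma pderiv_at_eqI:
  "(\<phi> has_derivative D) (at x) \<Longrightarrow> pderiv_at i \<phi> x = D (axis i 1)"
  unfolding pderiv_at_def using frechet_derivative_at by metis

lemma pderiv_at_zero [simp]: "pderiv_at i (\<lambda>x. 0) x = 0"
  by (rule pderiv_at_eqI) simp

lemma pderiv_at_add:
  assumes "\<phi> differentiable (at x)" "\<psi> differentiable (at x)"
  shows "pderiv_at i (\<lambda>y. \<phi> y + \<psi> y) x = pderiv_at i \<phi> x + pderiv_at i \<psi> x"
  using assms[unfolded frechet_derivative_works]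
  by (subst pderiv_at_eqI[OF has_derivative_add]) (auto simp: pderiv_at_def)

lemma pderiv_at_mult:
  assumes "\<phi> differentiable (at x)" "\<psi> differentiable (at x)"
  shows "pderiv_at i (\<lambda>y. \<phi> y * \<psi> y) x = \<phi> x * pderiv_at i \<psi> x + pderiv_at i \<phi> x * \<psi> x"
  using assms[unfolded frechet_derivative_works]
  by (subst pderiv_at_eqI[OF has_derivative_mult]) (auto simp: pderiv_at_def)

lemma Ck_SucD: "Ck (Suc k) \<phi> \<Longrightarrow> Ck k \<phi>"
proof (induction k arbitrary: \<phi>)
  case 0
  then show ?case
    by (auto simp: continuous_on_eq_continuous_at differentiable_imp_continuous_within)
next
  case (Suc k)
  then show ?case by (metis Ck.simps(2))
qed

lemma Ck_add: "Ck k \<phi> \<Longrightarrow> Ck k \<psi> \<Longrightarrow> Ck k (\<lambda>x. \<phi> x + \<psi> x)"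
proof (induction k arbitrary: \<phi> \<psi>)
  case 0
  then show ?case by (auto intro: continuous_intros)
next
  case (Suc k)
  then have "pderiv_at i (\<lambda>y. \<phi> y + \<psi> y) = (\<lambda>x. pderiv_at i \<phi> x + pderiv_at i \<psi> x)" for i
    by (auto intro!: ext pderiv_at_add)
  with Suc show ?case by (auto intro: differentiable_add)
qed

lemma Ck_mult: "Ck k \<phi> \<Longrightarrow> Ck k \<psi> \<Longrightarrow> Ck k (\<lambda>x. \<phi> x * \<psi> x)"
proof (induction k arbitrary: \<phi> \<psi>)
  case 0
  then show ?case by (auto intro: continuous_intros)
next
  case (Suc k)
  then have "pderiv_at i (\<lambda>y. \<phi> y * \<psi> y) = (\<lambda>x. \<phi> x * pderiv_at i \<psi> x + pderiv_at i \<phi> x * \<psi> x)" for i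
    by (auto intro!: ext pderiv_at_mult)
  moreover have "Ck k (\<lambda>x. \<phi> x * pderiv_at i \<psi> x + pderiv_at i \<phi> x * \<psi> x)" for i
    using Suc.prems Ck_SucD[OF Suc.prems(1)] Ck_SucD[OF Suc.prems(2)]
    by (intro Ck_add Suc.IH) simp_all
  moreover have "(\<lambda>y. \<phi> y * \<psi> y) differentiable at x" for x
    using Suc.prems by (intro differentiable_mult) simp_all
  ultimately show ?case by simp
qed

lemma Ck_zero: "Ck k (\<lambda>x. 0)"
proof (induction k)
  case (Suc k)
  have "pderiv_at i (\<lambda>x. 0) = (\<lambda>x. 0)" for i by (rule ext) simp
  with Suc show ?case by simp
qed simp

lemma test_fun_D:
  assumes "\<phi> \<in> test_fun \<Omega>"
  shows "Ck k \<phi>" "\<phi> differentiable (at x)" "continuous_on UNIV \<phi>"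
proof -
  show C: "Ck k \<phi>" for k using assms by (simp add: test_fun_def)
  show "\<phi> differentiable (at x)" using C[of "Suc 0"] by simp
  show "continuous_on UNIV \<phi>" using C[of 0] by simp
qed

text \<open>
  Products and derivatives of test functions are test functions for one reason: smoothness is
  preserved and the support does not grow.
\<close>
lemma test_fun_subset_support:
  assumes "\<phi> \<in> test_fun \<Omega>" "\<And>k. Ck k \<psi>" "{x. \<psi> x \<noteq> 0} \<subseteq> closure {x. \<phi> x \<noteq> 0}"
  shows "\<psi> \<in> test_fun \<Omega>"
proof -
  have "closure {x. \<psi> x \<noteq> 0} \<subseteq> closure {x. \<phi> x \<noteq> 0}"
    using assms(3) by (simp add: closure_minimal)
  moreover have "compact (closure {x. \<psi> x \<noteq> 0})"
    using compact_Int_closed[of "closure {x. \<phi> x \<noteq> 0}" "closure {x. \<psi> x \<noteq> 0}"] assms(1) calculation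
    by (simp add: test_fun_def inf.absorb2)
  ultimately show ?thesis
    using assms(1,2) by (auto simp: test_fun_def)
qed

lemma test_fun_mult:
  assumes "\<phi> \<in> test_fun \<Omega>" "\<psi> \<in> test_fun \<Omega>"
  shows "(\<lambda>x. \<phi> x * \<psi> x) \<in> test_fun \<Omega>"
  by (rule test_fun_subset_support[OF assms(1)])
     (use assms closure_subset[of "{x. \<phi> x \<noteq> 0}"] in \<open>auto intro: Ck_mult test_fun_D\<close>)

lemma test_fun_pderiv_at:
  assumes "\<phi> \<in> test_fun \<Omega>"
  shows "pderiv_at i \<phi> \<in> test_fun \<Omega>"
proof (rule test_fun_subset_support[OF assms])
  show "Ck k (pderiv_at i \<phi>)" for k
    using test_fun_D(1)[OF assms, of "Suc k"] by simp
  show "{x. pderiv_at i \<phi> x \<noteq> 0} \<subseteq> closure {x. \<phi> x \<noteq> 0}"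
  proof (rule ccontr)
    assume "\<not> ?thesis"
    then obtain x where x: "pderiv_at i \<phi> x \<noteq> 0" "x \<in> - closure {x. \<phi> x \<noteq> 0}" by auto
    have "((\<lambda>x. 0) has_derivative (\<lambda>h. 0)) (at x)" by simp
    then have "(\<phi> has_derivative (\<lambda>h. 0)) (at x)"
    proof (rule has_derivative_transform_within_open)
      show "open (- closure {x. \<phi> x \<noteq> 0})" by auto
      show "0 = \<phi> y" if "y \<in> - closure {x. \<phi> x \<noteq> 0}" for y
        using that closure_subset[of "{x. \<phi> x \<noteq> 0}"] by auto
    qed (use x in auto)
    then show False using x(1) pderiv_at_eqI by fastforce
  qed
qed

lemma test_field_classical_grad:
  "\<phi> \<in> test_fun \<Omega> \<Longrightarrow> classical_grad \<phi> \<in> test_field \<Omega>"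
  by (simp add: test_field_def classical_grad_def test_fun_pderiv_at)

lemma test_fun_bounded:
  assumes "\<phi> \<in> test_fun \<Omega>"
  obtains M where "\<forall>x. \<bar>\<phi> x\<bar> \<le> M"
proof -
  let ?K = "closure {x. \<phi> x \<noteq> 0}"
  have "bounded (\<phi> ` ?K)"
    using assms test_fun_D(3)[OF assms]
    by (auto simp: test_fun_def intro!: compact_imp_bounded compact_continuous_image
        intro: continuous_on_subset)
  then obtain M where M: "\<And>x. x \<in> ?K \<Longrightarrow> \<bar>\<phi> x\<bar> \<le> M"
    by (auto simp: bounded_iff)
  have "\<bar>\<phi> x\<bar> \<le> max M 0" for x
  proof (cases "\<phi> x = 0")
    case False
    then have "x \<in> ?K" using closure_subset by fastforce
    then show ?thesis using M by fastforce
  qed simp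
  then show ?thesis using that by blast
qed

text \<open>
  Boundedness of the domain enters here: it makes constants integrable, so that a bounded continuous
  function is square integrable.
\<close>
lemma test_fun_L2:
  assumes "open \<Omega>" "bounded \<Omega>" "\<phi> \<in> test_fun \<Omega>'"
  shows "\<phi> \<in> L2 \<Omega>"
proof -
  obtain M where M: "\<forall>x. \<bar>\<phi> x\<bar> \<le> M" using test_fun_bounded[OF assms(3)] .
  have "\<Omega> \<in> lmeasurable" using assms by (simp add: lmeasurable_open)
  then interpret finite_measure "lebesgue_on \<Omega>" by (rule finite_measure_lebesgue_on)
  show ?thesis
  proof (rule L2_dominated)
    show "\<phi> \<in> borel_measurable (lebesgue_on \<Omega>)"
      using assms(1) test_fun_D(3)[OF assms(3)]
      by (intro continuous_imp_measurable_on_sets_lebesgue)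
         (auto intro: continuous_on_subset)
    show "integrable (lebesgue_on \<Omega>) (\<lambda>x. M\<^sup>2)" by simp
    show "AE x in lebesgue_on \<Omega>. (norm (\<phi> x))\<^sup>2 \<le> M\<^sup>2"
      using M by (intro always_eventually allI power_mono) auto
  qed
qed

lemma test_field_L2:
  assumes "open \<Omega>" "bounded \<Omega>" "\<Phi> \<in> test_field \<Omega>'"
  shows "\<Phi> \<in> L2 \<Omega>"
  using assms by (intro L2_vecI test_fun_L2) (auto simp: test_field_def)

section \<open>Weak derivatives\<close>

lemma H1_wgrad: "u \<in> H1 \<Omega> \<Longrightarrow> has_weak_grad \<Omega> u (wgrad \<Omega> u)"
  unfolding H1_def wgrad_def by (auto intro: someI[where P = "has_weak_grad \<Omega> u"])

lemma wgrad_L2: "u \<in> H1 \<Omega> \<Longrightarrow> wgrad \<Omega> u \<in> L2 \<Omega>"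
  using H1_wgrad unfolding has_weak_grad_def by blast

lemma H_curl_wcurl: "u \<in> H_curl \<Omega> \<Longrightarrow> has_weak_curl \<Omega> u (wcurl \<Omega> u)"
  unfolding H_curl_def wcurl_def by (auto intro: someI[where P = "has_weak_curl \<Omega> u"])

lemma H_div_wdiv: "u \<in> H_div \<Omega> \<Longrightarrow> has_weak_div \<Omega> u (wdiv \<Omega> u)"
  unfolding H_div_def wdiv_def by (auto intro: someI[where P = "has_weak_div \<Omega> u"])

text \<open>
  The trace of the weak gradient is a weak divergence, as one sees by inserting the test field
  \<open>\<phi> e\<^sub>i\<close> into the definition of the weak gradient of \<open>u\<^sub>i\<close>. This makes \<open>wdiv \<Omega> u\<close> an actual weak
  divergence of a velocity instead of an arbitrary choice, so that \<open>wdiv \<Omega> u = 0\<close> can be tested.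
\<close>
lemma H1_vec_imp_H_div:
  assumes \<Omega>: "open \<Omega>" "bounded \<Omega>" and u: "u \<in> H1_vec \<Omega>"
  shows "u \<in> H_div \<Omega>"
proof -
  define g where "g i = wgrad \<Omega> (\<lambda>x. u x $ i)" for i
  have ui: "(\<lambda>x. u x $ i) \<in> L2 \<Omega>" and wg: "has_weak_grad \<Omega> (\<lambda>x. u x $ i) (g i)" for i
    using u by (auto simp: H1_vec_def H1_def g_def intro!: H1_wgrad)
  have gi: "(\<lambda>x. g i x $ i) \<in> L2 \<Omega>" for i
    using wg by (auto simp: has_weak_grad_def intro: L2_vec_nth)
  have "has_weak_div \<Omega> u (\<lambda>x. \<Sum>i\<in>UNIV. g i x $ i)"
    unfolding has_weak_div_def
  proof (intro conjI ballI)
    have "(\<lambda>x. g 1 x $ 1 + g 2 x $ 2 + g 3 x $ 3) \<in> L2 \<Omega>"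
      by (intro L2_add gi)
    then show "(\<lambda>x. \<Sum>i\<in>UNIV. g i x $ i) \<in> L2 \<Omega>" by (simp add: sum_3)
    fix \<phi> assume \<phi>: "\<phi> \<in> test_fun \<Omega>"
    have key: "L2_inner \<Omega> (\<lambda>x. g i x $ i) \<phi> = - L2_inner \<Omega> (\<lambda>x. u x $ i) (pderiv_at i \<phi>)" for i
    proof -
      let ?\<Phi> = "\<lambda>x. axis i (\<phi> x) :: real^3"
      have zero: "(\<lambda>x. 0) \<in> test_fun \<Omega>" by (simp add: test_fun_def Ck_zero)
      have "(\<lambda>x. ?\<Phi> x $ k) \<in> test_fun \<Omega>" for k
        by (cases "k = i") (simp_all add: axis_def \<phi> zero)
      then have "?\<Phi> \<in> test_field \<Omega>"
        by (simp add: test_field_def)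
      then have "L2_inner \<Omega> (g i) ?\<Phi> = - L2_inner \<Omega> (\<lambda>x. u x $ i) (classical_div ?\<Phi>)"
        using wg by (simp add: has_weak_grad_def)
      moreover have "classical_div ?\<Phi> = pderiv_at i \<phi>"
      proof
        fix x
        have "pderiv_at k (\<lambda>y. ?\<Phi> y $ k) x = (if k = i then pderiv_at i \<phi> x else 0)" for k
          by (cases "k = i") (simp_all add: axis_def)
        then show "classical_div ?\<Phi> x = pderiv_at i \<phi> x"
          by (simp add: classical_div_def)
      qed
      ultimately show ?thesis by (simp add: L2_inner_def inner_axis)
    qed
    have "L2_inner \<Omega> (\<lambda>x. \<Sum>i\<in>UNIV. g i x $ i) \<phi> = (\<Sum>i\<in>UNIV. L2_inner \<Omega> (\<lambda>x. g i x $ i) \<phi>)"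
      unfolding L2_inner_def inner_sum_left
      by (rule Bochner_Integration.integral_sum)
         (rule L2_inner_integrable[OF gi test_fun_L2[OF \<Omega> \<phi>]])
    also have "\<dots> = - (\<Sum>i\<in>UNIV. L2_inner \<Omega> (\<lambda>x. u x $ i) (pderiv_at i \<phi>))"
      by (simp add: key sum_negf)
    also have "\<dots> = - L2_inner \<Omega> u (classical_grad \<phi>)"
      using ui test_fun_L2[OF \<Omega> test_fun_pderiv_at[OF \<phi>]]
      by (subst L2_inner_vec) (auto simp: classical_grad_def)
    finally show "L2_inner \<Omega> (\<lambda>x. \<Sum>i\<in>UNIV. g i x $ i) \<phi> = - L2_inner \<Omega> u (classical_grad \<phi>)" .
  qed
  moreover have "u \<in> L2 \<Omega>" by (rule L2_vecI[OF ui])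
  ultimately show ?thesis by (auto simp: H_div_def)
qed

lemma H1_0_vec_subset: "H1_0_vec \<Omega> \<subseteq> H1_vec \<Omega>"
  by (auto simp: H1_0_vec_def H1_vec_def H1_0_def)

section \<open>The convection term\<close>

text \<open>
  On each of the finitely many cells the function extends continuously to a compact set, and the cell
  boundaries, being frontiers of convex sets, are negligible.
\<close>
lemma fe_space_AE_bounded:
  assumes "fe_space \<Omega> V" "v \<in> V" "open \<Omega>"
  obtains M where "0 \<le> M" "AE x in lebesgue_on \<Omega>. norm (v x) \<le> M"
proof -
  obtain \<T> where \<T>: "mesh \<Omega> \<T>"
    and g: "\<forall>K\<in>\<T>. \<exists>g. continuous_on K g \<and> (\<forall>x\<in>interior K. v x = g x)"
    using assms(1)[unfolded fe_space_def, THEN conjunct2] assms(2) by blast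
  have poly: "polytope K" if "K \<in> \<T>" for K using \<T> that by (auto simp: mesh_def)
  have "\<exists>M. \<forall>x\<in>interior K. norm (v x) \<le> M" if K: "K \<in> \<T>" for K
  proof -
    obtain h where h: "continuous_on K h" "\<forall>x\<in>interior K. v x = h x" using g K by blast
    have "bounded (h ` K)"
      using h(1) polytope_imp_compact[OF poly[OF K]]
      by (intro compact_imp_bounded compact_continuous_image)
    then show ?thesis using h(2) interior_subset[of K] by (auto simp: bounded_iff)
  qed
  then obtain M where M: "\<And>K x. K \<in> \<T> \<Longrightarrow> x \<in> interior K \<Longrightarrow> norm (v x) \<le> M K" by metis
  have fin: "finite \<T>" using \<T> by (simp add: mesh_def)
  have "negligible (\<Union>K\<in>\<T>. frontier K)"
    using fin poly by (intro negligible_Union) (auto intro!: negligible_convex_frontier polytope_imp_convex)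
  then have "AE x in lebesgue. x \<notin> (\<Union>K\<in>\<T>. frontier K)"
    by (intro AE_not_in) (simp add: negligible_iff_null_sets)
  then have ae: "AE x in lebesgue_on \<Omega>. x \<notin> (\<Union>K\<in>\<T>. frontier K)"
    using assms(3) by (subst AE_restrict_space_iff) auto
  have bound: "norm (v x) \<le> (\<Sum>K\<in>\<T>. \<bar>M K\<bar>)" if x: "x \<in> \<Omega>" "x \<notin> (\<Union>K\<in>\<T>. frontier K)" for x
  proof -
    obtain K where K: "K \<in> \<T>" "x \<in> K"
      using x(1) \<T> closure_subset[of \<Omega>] that unfolding mesh_def by (metis UnionE subsetD)
    then have "x \<in> interior K"
      using x(2) closure_subset[of K] by (auto simp: frontier_def)
    then have "norm (v x) \<le> \<bar>M K\<bar>"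
      using M[OF K(1)] order_trans[OF _ abs_ge_self] by blast
    also have "\<dots> \<le> (\<Sum>K\<in>\<T>. \<bar>M K\<bar>)" using K(1) fin by (intro member_le_sum) auto
    finally show ?thesis .
  qed
  have "AE x in lebesgue_on \<Omega>. norm (v x) \<le> (\<Sum>K\<in>\<T>. \<bar>M K\<bar>)"
    using ae AE_space[of "lebesgue_on \<Omega>"] by eventually_elim (rule bound, simp_all)
  then show ?thesis by (rule that[rotated]) (auto intro: sum_nonneg)
qed

text \<open>
  Formally \<open>\<integral>s w \<cdot> \<nabla>s = - 1/2 \<integral>s\<^sup>2 div w\<close>. With test functions \<open>\<phi>\<^sub>n\<close> in place of \<open>s\<close> the square
  \<open>\<phi>\<^sub>n\<^sup>2\<close> is an admissible test function for \<open>div w = 0\<close>, and the bound on \<open>w\<close> turns \<open>\<phi>\<^sub>n \<rightarrow> s\<close> into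
  \<open>\<phi>\<^sub>n w \<rightarrow> s w\<close> in \<open>L\<^sup>2\<close>.
\<close>
lemma transport_energy_zero:
  assumes \<Omega>: "open \<Omega>" "bounded \<Omega>"
    and w: "w \<in> H_div \<Omega>" "ae_eq \<Omega> (wdiv \<Omega> w) (\<lambda>x. 0)"
    and M: "0 \<le> M" "AE x in lebesgue_on \<Omega>. norm (w x) \<le> M"
    and s: "s \<in> H1_0 \<Omega>"
  shows "L2_inner \<Omega> (wgrad \<Omega> s) (\<lambda>x. s x *\<^sub>R w x) = 0"
    and "(\<lambda>x. s x *\<^sub>R w x) \<in> L2 \<Omega>"
proof -
  obtain \<phi> where \<phi>: "\<And>n. \<phi> n \<in> test_fun \<Omega>"
    and lim: "(\<lambda>n. L2_norm \<Omega> (\<lambda>x. \<phi> n x - s x)) \<longlonglongrightarrow> 0"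
      "(\<lambda>n. L2_norm \<Omega> (\<lambda>x. classical_grad (\<phi> n) x - wgrad \<Omega> s x)) \<longlonglongrightarrow> 0"
    using s unfolding H1_0_def by blast
  have gL2: "wgrad \<Omega> s \<in> L2 \<Omega>" using s by (intro wgrad_L2) (simp add: H1_0_def)
  have sL2: "s \<in> L2 \<Omega>" using s by (simp add: H1_0_def H1_def)
  have wL2: "w \<in> L2 \<Omega>" using w by (simp add: H_div_def)
  have \<phi>L2: "\<phi> n \<in> L2 \<Omega>" for n by (rule test_fun_L2[OF \<Omega> \<phi>])
  have bil: "bounded_bilinear (\<lambda>(a::real^3) (b::real). b *\<^sub>R a)"
    by (rule bounded_bilinear.flip[OF bounded_bilinear_scaleR])
  note mult = L2_bilinear_bounded_factor[OF bil _ L2_measurable[OF wL2] M(2)]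
  have smult: "(\<lambda>x. r x *\<^sub>R w x) \<in> L2 \<Omega>" "L2_norm \<Omega> (\<lambda>x. r x *\<^sub>R w x) \<le> M * L2_norm \<Omega> r"
    if "r \<in> L2 \<Omega>" for r
    using mult[of r] that M(1) by (simp_all add: mult.commute)
  show sw: "(\<lambda>x. s x *\<^sub>R w x) \<in> L2 \<Omega>" by (rule smult(1)[OF sL2])
  have "(\<lambda>n. L2_norm \<Omega> (\<lambda>x. \<phi> n x *\<^sub>R w x - s x *\<^sub>R w x)) \<longlonglongrightarrow> 0"
  proof (rule Lim_null_comparison)
    show "\<forall>\<^sub>F n in sequentially. norm (L2_norm \<Omega> (\<lambda>x. \<phi> n x *\<^sub>R w x - s x *\<^sub>R w x))
        \<le> M * L2_norm \<Omega> (\<lambda>x. \<phi> n x - s x)"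
      using smult(2)[OF L2_diff[OF \<phi>L2 sL2]] by (simp add: scaleR_diff_left)
    show "(\<lambda>n. M * L2_norm \<Omega> (\<lambda>x. \<phi> n x - s x)) \<longlonglongrightarrow> 0"
      using tendsto_mult_left[OF lim(1), of M] by simp
  qed
  then have conv: "(\<lambda>n. L2_inner \<Omega> (classical_grad (\<phi> n)) (\<lambda>x. \<phi> n x *\<^sub>R w x))
      \<longlonglongrightarrow> L2_inner \<Omega> (wgrad \<Omega> s) (\<lambda>x. s x *\<^sub>R w x)"
    using lim(2) gL2 sw smult(1)[OF \<phi>L2] test_field_L2[OF \<Omega> test_field_classical_grad[OF \<phi>]]
    by (intro L2_inner_tendsto)
  have "L2_inner \<Omega> (classical_grad (\<phi> n)) (\<lambda>x. \<phi> n x *\<^sub>R w x) = 0" for n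
  proof -
    let ?q = "\<lambda>x. \<phi> n x * \<phi> n x"
    have "L2_inner \<Omega> (wdiv \<Omega> w) ?q = - L2_inner \<Omega> w (classical_grad ?q)"
      using H_div_wdiv[OF w(1)] test_fun_mult[OF \<phi> \<phi>] by (simp add: has_weak_div_def)
    moreover have "L2_inner \<Omega> (wdiv \<Omega> w) ?q = 0"
      using w(2) by (intro L2_inner_eq_0_AE) (auto simp: ae_eq_def)
    moreover have "classical_grad ?q = (\<lambda>x. (2 * \<phi> n x) *\<^sub>R classical_grad (\<phi> n) x)"
      using pderiv_at_mult[OF test_fun_D(2)[OF \<phi>] test_fun_D(2)[OF \<phi>]]
      by (auto simp: classical_grad_def vec_eq_iff)
    then have "L2_inner \<Omega> w (classical_grad ?q)
        = (LINT x|lebesgue_on \<Omega>. 2 * (classical_grad (\<phi> n) x \<bullet> (\<phi> n x *\<^sub>R w x)))"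
      by (simp add: L2_inner_def inner_commute mult_ac)
    then have "L2_inner \<Omega> w (classical_grad ?q)
        = 2 * L2_inner \<Omega> (classical_grad (\<phi> n)) (\<lambda>x. \<phi> n x *\<^sub>R w x)"
      by (simp add: L2_inner_def)
    ultimately show ?thesis by simp
  qed
  with conv show "L2_inner \<Omega> (wgrad \<Omega> s) (\<lambda>x. s x *\<^sub>R w x) = 0"
    by (simp add: LIMSEQ_const_iff)
qed

text \<open>
  Each velocity component is transported as a scalar, so the energies of the three components can be
  treated separately.
\<close>
lemma convection_energy_zero:
  assumes \<Omega>: "open \<Omega>" "bounded \<Omega>"
    and w: "w \<in> H_div \<Omega>" "ae_eq \<Omega> (wdiv \<Omega> w) (\<lambda>x. 0)"
    and M: "0 \<le> M" "AE x in lebesgue_on \<Omega>. norm (w x) \<le> M"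
    and u: "u \<in> H1_0_vec \<Omega>"
  shows "L2_inner \<Omega> (convect \<Omega> w u) u = 0"
proof -
  have ui: "(\<lambda>x. u x $ i) \<in> H1_0 \<Omega>" for i using u by (simp add: H1_0_vec_def)
  have gi: "wgrad \<Omega> (\<lambda>x. u x $ i) \<in> L2 \<Omega>" for i
    using ui[of i] by (intro wgrad_L2) (simp add: H1_0_def)
  note z = transport_energy_zero[OF \<Omega> w M ui]
  have "L2_inner \<Omega> (convect \<Omega> w u) u
      = (LINT x|lebesgue_on \<Omega>. (\<Sum>i\<in>UNIV. wgrad \<Omega> (\<lambda>x. u x $ i) x \<bullet> (u x $ i *\<^sub>R w x)))"
    unfolding L2_inner_def
    by (intro Bochner_Integration.integral_cong refl, subst inner_vec_def)
       (simp add: convect_def wGrad_def matrix_vector_mul_component mult.commute)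
  also have "\<dots> = (\<Sum>i\<in>UNIV. L2_inner \<Omega> (wgrad \<Omega> (\<lambda>x. u x $ i)) (\<lambda>x. u x $ i *\<^sub>R w x))"
    unfolding L2_inner_def
    by (rule Bochner_Integration.integral_sum) (rule L2_inner_integrable[OF gi z(2)])
  finally show ?thesis by (simp add: z(1))
qed

section \<open>The dual norm\<close>

text \<open>
  Uniqueness of the weak gradient at \<open>0\<close>. On \<open>H\<^sup>1\<^sub>0\<close> the fundamental lemma of the calculus of
  variations can be avoided: the gradients \<open>\<nabla>\<phi>\<^sub>n\<close> of the approximating test functions are themselves
  test fields, and \<open>(\<nabla>s, \<nabla>\<phi>\<^sub>n) = - (s, \<Delta>\<phi>\<^sub>n) = 0\<close> tends to \<open>\<parallel>\<nabla>s\<parallel>\<^sup>2\<close>.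
\<close>
lemma L2_norm_wgrad_AE_zero:
  assumes \<Omega>: "open \<Omega>" "bounded \<Omega>" and s: "s \<in> H1_0 \<Omega>" "ae_eq \<Omega> s (\<lambda>x. 0)"
  shows "L2_norm \<Omega> (wgrad \<Omega> s) = 0"
proof -
  obtain \<phi> where \<phi>: "\<And>n. \<phi> n \<in> test_fun \<Omega>"
    and lim: "(\<lambda>n. L2_norm \<Omega> (\<lambda>x. classical_grad (\<phi> n) x - wgrad \<Omega> s x)) \<longlonglongrightarrow> 0"
    using s(1) unfolding H1_0_def by blast
  have wg: "has_weak_grad \<Omega> s (wgrad \<Omega> s)" using s H1_wgrad[of s \<Omega>] by (simp add: H1_0_def)
  then have gL2: "wgrad \<Omega> s \<in> L2 \<Omega>" by (simp add: has_weak_grad_def)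
  have const: "(\<lambda>n. L2_norm \<Omega> (\<lambda>x. wgrad \<Omega> s x - wgrad \<Omega> s x)) \<longlonglongrightarrow> 0"
    by (simp add: L2_norm_def L2_inner_def)
  have "(\<lambda>n. L2_inner \<Omega> (wgrad \<Omega> s) (classical_grad (\<phi> n))) \<longlonglongrightarrow> L2_inner \<Omega> (wgrad \<Omega> s) (wgrad \<Omega> s)"
    using gL2 test_field_L2[OF \<Omega> test_field_classical_grad[OF \<phi>]] lim const
    by (intro L2_inner_tendsto)
  moreover have "L2_inner \<Omega> (wgrad \<Omega> s) (classical_grad (\<phi> n)) = 0" for n
  proof -
    have "L2_inner \<Omega> s (classical_div (classical_grad (\<phi> n))) = 0"
      using s(2) by (intro L2_inner_eq_0_AE) (auto simp: ae_eq_def)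
    then show ?thesis
      using wg test_field_classical_grad[OF \<phi>] by (simp add: has_weak_grad_def)
  qed
  ultimately show ?thesis by (simp add: LIMSEQ_const_iff L2_norm_def)
qed

lemma L2_norm_wGrad:
  assumes u: "u \<in> H1_vec \<Omega>"
  shows "(L2_norm \<Omega> (wGrad \<Omega> u))\<^sup>2 = (\<Sum>i\<in>UNIV. (L2_norm \<Omega> (wgrad \<Omega> (\<lambda>x. u x $ i)))\<^sup>2)"
proof -
  have "wgrad \<Omega> (\<lambda>x. u x $ i) \<in> L2 \<Omega>" for i
    using u by (intro wgrad_L2) (simp add: H1_vec_def)
  then show ?thesis
    unfolding L2_norm_power2 by (subst L2_inner_vec) (simp_all add: wGrad_def)
qed

lemma L2_norm_wgrad_le_wGrad:
  assumes u: "u \<in> H1_vec \<Omega>"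
  shows "L2_norm \<Omega> (wgrad \<Omega> (\<lambda>x. u x $ i)) \<le> L2_norm \<Omega> (wGrad \<Omega> u)"
proof (rule power2_le_imp_le)
  show "(L2_norm \<Omega> (wgrad \<Omega> (\<lambda>x. u x $ i)))\<^sup>2 \<le> (L2_norm \<Omega> (wGrad \<Omega> u))\<^sup>2"
    unfolding L2_norm_wGrad[OF u]
    by (rule member_le_sum[of i UNIV "\<lambda>i. (L2_norm \<Omega> (wgrad \<Omega> (\<lambda>x. u x $ i)))\<^sup>2"]) simp_all
qed simp

text \<open>
  Boundedness of each component of \<open>f\<close> makes the supremum in \<open>dual_norm\<close> one of a set bounded above, and
  forces \<open>pairing f v = 0\<close> when \<open>\<nabla>v = 0\<close>.
\<close>
lemma H_minus1_vec_bounded: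
  assumes "f \<in> H_minus1_vec \<Omega>"
  obtains C where "0 \<le> C" "\<And>v. v \<in> H1_0_vec \<Omega> \<Longrightarrow> \<bar>pairing f v\<bar> \<le> C * L2_norm \<Omega> (wGrad \<Omega> v)"
proof -
  have "\<forall>i. \<exists>C. \<forall>v\<in>H1_0 \<Omega>. \<bar>(f $ i) v\<bar> \<le> C * L2_norm \<Omega> (wgrad \<Omega> v)"
    using assms unfolding H_minus1_vec_def H_minus1_def mem_Collect_eq by blast
  then obtain C where C: "\<And>i v. v \<in> H1_0 \<Omega> \<Longrightarrow> \<bar>(f $ i) v\<bar> \<le> C i * L2_norm \<Omega> (wgrad \<Omega> v)"
    by metis
  have "\<bar>pairing f v\<bar> \<le> (\<Sum>i\<in>UNIV. \<bar>C i\<bar>) * L2_norm \<Omega> (wGrad \<Omega> v)" if v: "v \<in> H1_0_vec \<Omega>" for v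
  proof -
    have v': "v \<in> H1_vec \<Omega>" using v H1_0_vec_subset by blast
    have "\<bar>(f $ i) (\<lambda>x. v x $ i)\<bar> \<le> \<bar>C i\<bar> * L2_norm \<Omega> (wGrad \<Omega> v)" for i
    proof -
      have "\<bar>(f $ i) (\<lambda>x. v x $ i)\<bar> \<le> C i * L2_norm \<Omega> (wgrad \<Omega> (\<lambda>x. v x $ i))"
        using C v by (simp add: H1_0_vec_def)
      also have "\<dots> \<le> \<bar>C i\<bar> * L2_norm \<Omega> (wGrad \<Omega> v)"
        using L2_norm_wgrad_le_wGrad[OF v'] by (intro mult_mono) auto
      finally show ?thesis .
    qed
    then have "(\<Sum>i\<in>UNIV. \<bar>(f $ i) (\<lambda>x. v x $ i)\<bar>) \<le> (\<Sum>i\<in>UNIV. \<bar>C i\<bar> * L2_norm \<Omega> (wGrad \<Omega> v))"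
      by (rule sum_mono)
    then show ?thesis
      unfolding pairing_def sum_distrib_right by (rule order_trans[OF sum_abs])
  qed
  moreover have "0 \<le> (\<Sum>i\<in>UNIV. \<bar>C i\<bar>)" by (simp add: sum_nonneg)
  ultimately show ?thesis using that by blast
qed

text \<open>
  The supremum in \<open>dual_norm\<close> excludes the fields that vanish almost everywhere; for those, and
  whenever \<open>\<nabla>v = 0\<close>, both sides are \<open>0\<close>. This case distinction replaces Poincare's inequality.
\<close>
lemma pairing_le_dual_norm:
  assumes \<Omega>: "open \<Omega>" "bounded \<Omega>" and f: "f \<in> H_minus1_vec \<Omega>" and v: "v \<in> H1_0_vec \<Omega>"
  shows "pairing f v \<le> dual_norm \<Omega> f * L2_norm \<Omega> (wGrad \<Omega> v)"
proof -
  obtain C where C: "0 \<le> C" "\<And>v. v \<in> H1_0_vec \<Omega> \<Longrightarrow> \<bar>pairing f v\<bar> \<le> C * L2_norm \<Omega> (wGrad \<Omega> v)"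
    by (rule H_minus1_vec_bounded[OF f]) blast
  show ?thesis
  proof (cases "L2_norm \<Omega> (wGrad \<Omega> v) = 0")
    case True
    then show ?thesis using C(2)[OF v] by simp
  next
    case False
    then have pos: "L2_norm \<Omega> (wGrad \<Omega> v) > 0" by (simp add: less_le)
    have "\<not> ae_eq \<Omega> v (\<lambda>x. 0)"
    proof
      assume "ae_eq \<Omega> v (\<lambda>x. 0)"
      then have ae: "AE x in lebesgue_on \<Omega>. v x = 0" by (simp add: ae_eq_def)
      have "ae_eq \<Omega> (\<lambda>x. v x $ i) (\<lambda>x. 0)" for i
        unfolding ae_eq_def using ae by eventually_elim simp
      then have "L2_norm \<Omega> (wgrad \<Omega> (\<lambda>x. v x $ i)) = 0" for i
        using v by (intro L2_norm_wgrad_AE_zero[OF \<Omega>]) (auto simp: H1_0_vec_def)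
      then show False
        using False L2_norm_wGrad[of v \<Omega>] v H1_0_vec_subset by auto
    qed
    moreover have "bdd_above ((\<lambda>v. pairing f v / L2_norm \<Omega> (wGrad \<Omega> v)) `
        {v \<in> H1_0_vec \<Omega>. \<not> ae_eq \<Omega> v (\<lambda>x. 0)})"
    proof (rule bdd_aboveI2)
      fix w assume "w \<in> {v \<in> H1_0_vec \<Omega>. \<not> ae_eq \<Omega> v (\<lambda>x. 0)}"
      then have "pairing f w \<le> C * L2_norm \<Omega> (wGrad \<Omega> w)" using C(2) abs_le_D1 by blast
      then show "pairing f w / L2_norm \<Omega> (wGrad \<Omega> w) \<le> C"
        using C(1) L2_norm_nonneg[of \<Omega> "wGrad \<Omega> w"]
        by (cases "L2_norm \<Omega> (wGrad \<Omega> w) = 0") (auto simp: divide_le_eq order_less_le)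
    qed
    ultimately have "pairing f v / L2_norm \<Omega> (wGrad \<Omega> v) \<le> dual_norm \<Omega> f"
      unfolding dual_norm_def using v by (intro cSUP_upper) auto
    then show ?thesis using pos by (simp add: divide_le_eq)
  qed
qed

section \<open>Structure preservation and energy law\<close>

theorem theorem1:
  fixes \<Omega> :: "(real^3) set"
    and Rey Rey\<^sub>m S R\<^sub>H :: real
    and Hg :: "(real^3 \<Rightarrow> real) set"
    and Hc Hd :: "(real^3 \<Rightarrow> real^3) set"
    and Lh :: "(real^3 \<Rightarrow> real) set"
    and Vh :: "(real^3 \<Rightarrow> real^3) set"
    and Qh :: "(real^3 \<Rightarrow> real) set"
    and f :: "((real^3 \<Rightarrow> real) \<Rightarrow> real)^3"
    and u E B j :: "real^3 \<Rightarrow> real^3"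
    and p :: "real^3 \<Rightarrow> real"
  assumes "lipschitz_polyhedron \<Omega>" and "simply_connected \<Omega>"
    and "Rey > 0" and "Rey\<^sub>m > 0" and "S > 0" and "R\<^sub>H \<ge> 0"
    and "fe_space \<Omega> Hg" and "Hg \<subseteq> H1_0 \<Omega>"
    and "fe_space \<Omega> Hc" and "Hc \<subseteq> H_curl_0 \<Omega>"
    and "fe_space \<Omega> Hd" and "Hd \<subseteq> H_div_0 \<Omega>"
    and "fe_space \<Omega> Lh" and "Lh \<subseteq> L2_0 \<Omega>"
    and "exact_de_Rham \<Omega> Hg Hc Hd Lh"
    and "fe_space \<Omega> Vh" and "Vh \<subseteq> H1_0_vec \<Omega>"
    and "fe_space \<Omega> Qh" and "Qh \<subseteq> L2_0 \<Omega>"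
    and "inf_sup_stable \<Omega> Vh Qh"
    and "exactly_incompressible \<Omega> Vh Qh"
    and "f \<in> H_minus1_vec \<Omega>"
    and "(u, p, E, B, j) \<in> Vh \<times> Qh \<times> Hc \<times> Hd \<times> Hc"
    and "\<forall>(v, q, F, C, k) \<in> Vh \<times> Qh \<times> Hc \<times> Hd \<times> Hc.
      inverse Rey * L2_inner \<Omega> (wGrad \<Omega> u) (wGrad \<Omega> v) + L2_inner \<Omega> (convect \<Omega> u u) v
        - S * L2_inner \<Omega> (\<lambda>x. cross3 (j x) (B x)) v - L2_inner \<Omega> p (wdiv \<Omega> v) = pairing f v \<and>
      L2_inner \<Omega> j F - L2_inner \<Omega> B (wcurl \<Omega> F) = 0 \<and>
      L2_inner \<Omega> (wcurl \<Omega> E) C + L2_inner \<Omega> (wdiv \<Omega> B) (wdiv \<Omega> C) = 0 \<and>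
      inverse Rey\<^sub>m * L2_inner \<Omega> j k
        - L2_inner \<Omega> (\<lambda>x. E x + cross3 (u x) (B x) - R\<^sub>H *\<^sub>R cross3 (j x) (B x)) k = 0 \<and>
      - L2_inner \<Omega> (wdiv \<Omega> u) q = 0"
  shows "ae_eq \<Omega> (wdiv \<Omega> B) (\<lambda>x. 0) \<and>
    ae_eq \<Omega> (wcurl \<Omega> E) (\<lambda>x. 0) \<and>
    inverse Rey * (L2_norm \<Omega> (wGrad \<Omega> u))\<^sup>2 + inverse Rey\<^sub>m * S * (L2_norm \<Omega> j)\<^sup>2 = pairing f u \<and>
    1/2 * inverse Rey * (L2_norm \<Omega> (wGrad \<Omega> u))\<^sup>2 + inverse Rey\<^sub>m * S * (L2_norm \<Omega> j)\<^sup>2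
      \<le> Rey / 2 * (dual_norm \<Omega> f)\<^sup>2"
proof -
  have \<Omega>: "open \<Omega>" "bounded \<Omega>"
    using assms(1) by (auto simp: lipschitz_polyhedron_def lipschitz_domain_def)
  have u: "u \<in> Vh" and p: "p \<in> Qh" and E: "E \<in> Hc" and B: "B \<in> Hd" and j: "j \<in> Hc"
    using assms(23) by auto
  have momentum: "inverse Rey * L2_inner \<Omega> (wGrad \<Omega> u) (wGrad \<Omega> u) + L2_inner \<Omega> (convect \<Omega> u u) u
        - S * L2_inner \<Omega> (\<lambda>x. cross3 (j x) (B x)) u - L2_inner \<Omega> p (wdiv \<Omega> u) = pairing f u"
    using assms(24) u p E B j by blast
  have ampere: "L2_inner \<Omega> j E - L2_inner \<Omega> B (wcurl \<Omega> E) = 0"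
    using assms(24) u p E B j by blast
  have faraday: "L2_inner \<Omega> (wcurl \<Omega> E) C + L2_inner \<Omega> (wdiv \<Omega> B) (wdiv \<Omega> C) = 0" if "C \<in> Hd" for C
    using assms(24) u p E that j by blast
  have ohm: "inverse Rey\<^sub>m * L2_inner \<Omega> j j
        - L2_inner \<Omega> (\<lambda>x. E x + cross3 (u x) (B x) - R\<^sub>H *\<^sub>R cross3 (j x) (B x)) j = 0"
    using assms(24) u p E B j by blast
  have mass: "L2_inner \<Omega> (wdiv \<Omega> u) q = 0" if "q \<in> Qh" for q
    using assms(24) u that E B j by fastforce
  have E_curl: "E \<in> H_curl \<Omega>" and j_L2: "j \<in> L2 \<Omega>" and B_div: "B \<in> H_div \<Omega>"
    using E j B assms(10,12) by (auto simp: H_curl_0_def H_curl_def H_div_0_def)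
  have E_L2: "E \<in> L2 \<Omega>" and B_L2: "B \<in> L2 \<Omega>"
    using E_curl B_div by (auto simp: H_curl_def H_div_def)
  have curlE_L2: "wcurl \<Omega> E \<in> L2 \<Omega>" and divB_L2: "wdiv \<Omega> B \<in> L2 \<Omega>"
    using H_curl_wcurl[OF E_curl] H_div_wdiv[OF B_div]
    by (auto simp: has_weak_curl_def has_weak_div_def)

  have curlE: "ae_eq \<Omega> (wcurl \<Omega> E) (\<lambda>x. 0)"
  proof -
    obtain C where C: "C \<in> Hd" "ae_eq \<Omega> C (wcurl \<Omega> E)"
      using assms(15) E by (auto simp: exact_de_Rham_def maps_into_def)
    then have "ae_eq \<Omega> (wdiv \<Omega> C) (\<lambda>x. 0)"
      using assms(15) E by (auto simp: exact_de_Rham_def in_range_def)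
    then have "L2_inner \<Omega> (wdiv \<Omega> B) (wdiv \<Omega> C) = 0"
      by (intro L2_inner_eq_0_AE) (auto simp: ae_eq_def)
    then have "L2_inner \<Omega> (wcurl \<Omega> E) C = 0"
      using faraday[OF C(1)] by simp
    moreover have "C \<in> L2 \<Omega>"
      using C(1) assms(12) by (auto simp: H_div_0_def H_div_def)
    \<comment> \<open>Replace the representative \<open>C\<close> by \<open>curl E\<close> itself.\<close>
    then have "L2_inner \<Omega> (wcurl \<Omega> E) (\<lambda>x. C x - wcurl \<Omega> E x)
        = L2_inner \<Omega> (wcurl \<Omega> E) C - L2_inner \<Omega> (wcurl \<Omega> E) (wcurl \<Omega> E)"
      by (rule L2_inner_diff_right[OF _ curlE_L2 curlE_L2])
    moreover have "L2_inner \<Omega> (wcurl \<Omega> E) (\<lambda>x. C x - wcurl \<Omega> E x) = 0"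
      using C(2) by (intro L2_inner_eq_0_AE) (auto simp: ae_eq_def)
    ultimately show ?thesis
      by (intro L2_inner_self_eq_0D[OF curlE_L2]) simp
  qed
  then have curlE_0: "L2_inner \<Omega> w (wcurl \<Omega> E) = 0" for w
    by (intro L2_inner_eq_0_AE) (auto simp: ae_eq_def)
  have divB: "ae_eq \<Omega> (wdiv \<Omega> B) (\<lambda>x. 0)"
    using faraday[OF B] curlE_0[of B]
    by (intro L2_inner_self_eq_0D[OF divB_L2]) (simp add: L2_inner_commute)

  have u_H10: "u \<in> H1_0_vec \<Omega>" using u assms(17) by blast
  then have u_div: "u \<in> H_div \<Omega>"
    using H1_vec_imp_H_div[OF \<Omega>] H1_0_vec_subset by blast
  then have u_L2: "u \<in> L2 \<Omega>" by (simp add: H_div_def)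
  obtain M where M: "0 \<le> M" "AE x in lebesgue_on \<Omega>. norm (u x) \<le> M"
    using fe_space_AE_bounded[OF assms(16) u \<Omega>(1)] .
  have divu: "ae_eq \<Omega> (wdiv \<Omega> u) (\<lambda>x. 0)"
    using assms(21) u mass by (auto simp: exactly_incompressible_def)
  have convection: "L2_inner \<Omega> (convect \<Omega> u u) u = 0"
    by (rule convection_energy_zero[OF \<Omega> u_div divu M u_H10])
  have pressure: "L2_inner \<Omega> p (wdiv \<Omega> u) = 0"
    using divu by (intro L2_inner_eq_0_AE) (auto simp: ae_eq_def)
  have uB_L2: "(\<lambda>x. cross3 (u x) (B x)) \<in> L2 \<Omega>"
    by (rule L2_cross3_bounded_factor[OF L2_measurable[OF u_L2] M(2) B_L2])
  \<comment> \<open>\<open>(j \<times> B) \<cdot> j = 0\<close> pointwise: the Hall field does no work on the current.\<close>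
  have "L2_inner \<Omega> (\<lambda>x. E x + cross3 (u x) (B x) - R\<^sub>H *\<^sub>R cross3 (j x) (B x)) j
      = L2_inner \<Omega> (\<lambda>x. E x + cross3 (u x) (B x)) j"
    by (simp add: L2_inner_def inner_diff_left dot_cross_self)
  also have "\<dots> = L2_inner \<Omega> E j + L2_inner \<Omega> (\<lambda>x. cross3 (u x) (B x)) j"
    by (rule L2_inner_add_left[OF E_L2 uB_L2 j_L2])
  also have "L2_inner \<Omega> E j = 0"
    using ampere curlE_0[of B] by (simp add: L2_inner_commute)
  finally have joule: "inverse Rey\<^sub>m * L2_inner \<Omega> j j = L2_inner \<Omega> (\<lambda>x. cross3 (u x) (B x)) j"
    using ohm by simp
  have "cross3 (j x) (B x) \<bullet> u x = - (cross3 (u x) (B x) \<bullet> j x)" for x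
    by (simp add: cross3_simps)
  then have lorentz: "L2_inner \<Omega> (\<lambda>x. cross3 (j x) (B x)) u = - L2_inner \<Omega> (\<lambda>x. cross3 (u x) (B x)) j"
    by (simp add: L2_inner_def)

  have energy: "inverse Rey * (L2_norm \<Omega> (wGrad \<Omega> u))\<^sup>2 + inverse Rey\<^sub>m * S * (L2_norm \<Omega> j)\<^sup>2 = pairing f u"
    using momentum unfolding convection pressure lorentz joule[symmetric] L2_norm_power2
    by (simp add: algebra_simps)
  let ?x = "L2_norm \<Omega> (wGrad \<Omega> u)" and ?D = "dual_norm \<Omega> f"
  have "pairing f u \<le> ?D * ?x"
    by (rule pairing_le_dual_norm[OF \<Omega> assms(22) u_H10])
  also have "\<dots> \<le> Rey / 2 * ?D\<^sup>2 + 1/2 * inverse Rey * ?x\<^sup>2"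
  proof -
    \<comment> \<open>Young's inequality, weighted so that half of the viscous term absorbs \<open>\<parallel>\<nabla>u\<parallel>\<^sup>2\<close>.\<close>
    have "0 \<le> inverse Rey / 2 * (Rey * ?D - ?x)\<^sup>2" using assms(3) by simp
    also have "\<dots> = Rey / 2 * ?D\<^sup>2 + 1/2 * inverse Rey * ?x\<^sup>2 - ?D * ?x"
      using assms(3) by (simp add: power2_eq_square field_simps)
    finally show ?thesis by simp
  qed
  finally show ?thesis
    using divB curlE energy by auto
qed

end
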